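(* Let $G$ be a simple graph containing at least one cycle, such that all cycles of $G$ are pairwise vertex-disjoint. Then the family $\mathcal{T}_G$ is not equienergetic; that is, there exist two $\mathbb{T}$-gain graphs $\Phi_1=(G,\varphi_1)$ and $\Phi_2=(G,\varphi_2)$ with $\mathcal{E}(\Phi_1)\ne\mathcal{E}(\Phi_2)$.
   Context: Let $\mathbb{T}=\{z\in\mathbb{C}:|z|=1\}$. A $\mathbb{T}$-gain graph $\Phi=(G,\varphi)$ is a simple graph $G$ with a map $\varphi$ assigning to each oriented edge $\vec e_{p,q}$ a value in $\mathbb{T}$ with $\varphi(\vec{e}_{p,q})=\varphi(\vec{e}_{q,p})^{-1}$; its adjacency matrix has $(p,q)$ entry $\varphi(\vec{e}_{p,q})$ if $v_p\sim v_q$ and $0$ otherwise, and its energy $\mathcal{E}(\Phi)$ is the sum of absolute values of its eigenvalues. $\mathcal{T}_G$ is the collection of all $\mathbb{T}$-gain graphs with underlying graph $G$; it is called equienergetic if all its members have the same energy. *)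

theory Defs
  imports
    "HOL-Library.FuncSet"
    "Graph_Theory.Pair_Digraph"
    "Jordan_Normal_Form.Char_Poly"
begin

text \<open>
  A finite simple graph is a \<^locale>\<open>pair_graph\<close>: a finite loop-free digraph with symmetric arc
  relation.  An edge between p and q is the pair of its two orientations (p, q) and (q, p), so
  \<^const>\<open>parcs\<close> is the set of oriented edges.
\<close>

text \<open>
  The library's directed cycles include p, q, p for every edge, hence the length bound.  The
  rotations and reversals of an arc list traverse one and the same cycle, so cycles are taken to
  be subgraphs and not arc lists.
\<close>

definition cycle_subgraph :: "('a \<times> 'a) list \<Rightarrow> 'a pair_pre_digraph" where
  "cycle_subgraph p = \<lparr> pverts = fst ` set p, parcs = set p \<union> (set p)\<inverse> \<rparr>"

definition graph_cycles :: "'a pair_pre_digraph \<Rightarrow> 'a pair_pre_digraph set" where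
  "graph_cycles G =
     cycle_subgraph ` {p. pre_digraph.cycle (with_proj G) p \<and> 3 \<le> length p}"

type_synonym 'a gain_graph = "'a pair_pre_digraph \<times> ('a \<times> 'a \<Rightarrow> complex)"

definition gain_graphs_on :: "'a pair_pre_digraph \<Rightarrow> 'a gain_graph set" where
  "gain_graphs_on G =
     {(G, \<phi>) | \<phi>. \<phi> \<in> parcs G \<rightarrow>\<^sub>E {z. cmod z = 1} \<and>
        (\<forall>(p, q) \<in> parcs G. \<phi> (p, q) = inverse (\<phi> (q, p)))}"

text \<open>
  The list \<open>vs\<close> numbers the vertices.  It is meant to contain each vertex exactly once; the
  matrices for two such numberings are permutation similar.
\<close>

definition adjacency_matrix :: "'a list \<Rightarrow> 'a gain_graph \<Rightarrow> complex mat" where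
  "adjacency_matrix vs \<Phi> =
     mat (length vs) (length vs)
       (\<lambda>(i, j). if (vs ! i, vs ! j) \<in> parcs (fst \<Phi>) then snd \<Phi> (vs ! i, vs ! j) else 0)"

text \<open>Eigenvalues are counted with algebraic multiplicity.\<close>

definition energy :: "'a list \<Rightarrow> 'a gain_graph \<Rightarrow> real" where
  "energy vs \<Phi> = (\<Sum>\<mu> \<in># proots (char_poly (adjacency_matrix vs \<Phi>)). cmod \<mu>)"

definition equienergetic :: "'a list \<Rightarrow> 'a gain_graph set \<Rightarrow> bool" where
  "equienergetic vs F \<longleftrightarrow> (\<forall>\<Phi>\<^sub>1 \<in> F. \<forall>\<Phi>\<^sub>2 \<in> F. energy vs \<Phi>\<^sub>1 = energy vs \<Phi>\<^sub>2)"

end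

theory Submission
  imports Defs "HOL-Real_Asymp.Real_Asymp" "HOL-Combinatorics.Cycles"
begin

text \<open>
  Let S be a real skew-symmetric signing of the adjacency matrix, so that A = iS is the adjacency
  matrix of a gain graph, and let pq be an edge of a cycle.  Multiplying the entry (p, q) by a
  unimodular z, and (q, p) by its conjugate, gives a gain graph with
  det (ix - A(z)) = i^n (a + b z + c conj z), where a, b and c are real for real x.
  For x > 0 the values at z = 1 and z = -1 are nonzero and have real factors of the same sign, so
  their product has modulus a^2 - (b + c)^2, whereas for z = i and z = -i the product has modulus
  a^2 + (b - c)^2, which is at least as large.  By Coulson's formula a difference of energies
  is the integral of the difference of the logarithms of the moduli, up to a positive factor, so
  if the four energies agree, then b + c = b - c = 0 for all
  x > 0.

  It remains to see that b does not vanish for every signing.  Flipping the signs of the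
  edges of the cycle, of length l, and taking the alternating sum over all flips leaves in the
  Leibniz formula for b only the permutations which follow the whole cycle.  Among these, only the
  rotation of the cycle contributes to the coefficient of x^(n - l).
\<close>

section \<open>Coulson's formula\<close>

text \<open>
  An antiderivative of \<open>ln (x\<^sup>2 + a\<^sup>2)\<close> which vanishes at 0 and is
  \<open>2 x ln x - 2 x + pi \<bar>a\<bar> + o(1)\<close> at infinity.  For \<open>a = 0\<close> the last summand is 0.
\<close>

definition coulson_primitive :: "real \<Rightarrow> real \<Rightarrow> real" where
  "coulson_primitive a x = x * ln (x\<^sup>2 + a\<^sup>2) - 2 * x + 2 * \<bar>a\<bar> * arctan (x / \<bar>a\<bar>)"

lemma coulson_primitive_deriv:
  assumes "x > 0"
  shows "(coulson_primitive a has_real_derivative ln (x\<^sup>2 + a\<^sup>2)) (at x)"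
proof -
  have pos: "x\<^sup>2 + a\<^sup>2 > 0" using assms by (simp add: add_pos_nonneg)
  show ?thesis
  proof (cases "a = 0")
    case True
    show ?thesis unfolding coulson_primitive_def True using assms
      by (auto intro!: derivative_eq_intros simp: power2_eq_square)
  next
    case False
    have cancel: "2 * \<bar>a\<bar> * (c * (1 / \<bar>a\<bar>)) = 2 * c" for c
      using False by (simp add: field_simps del: abs_mult_self_eq)
    have "((\<lambda>x. 2 * \<bar>a\<bar> * arctan (x / \<bar>a\<bar>)) has_real_derivative
        2 * \<bar>a\<bar> * (inverse (1 + (x / \<bar>a\<bar>)\<^sup>2) * (1 / \<bar>a\<bar>))) (at x)"
      by (intro DERIV_cmult DERIV_chain2[OF DERIV_arctan DERIV_cdivide[OF DERIV_ident]])
    also have "2 * \<bar>a\<bar> * (inverse (1 + (x / \<bar>a\<bar>)\<^sup>2) * (1 / \<bar>a\<bar>)) = 2 * inverse (1 + (x / \<bar>a\<bar>)\<^sup>2)"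
      by (rule cancel)
    also have "1 + (x / \<bar>a\<bar>)\<^sup>2 = (x\<^sup>2 + a\<^sup>2) / a\<^sup>2"
      using False by (simp add: field_simps)
    finally have "((\<lambda>x. 2 * \<bar>a\<bar> * arctan (x / \<bar>a\<bar>)) has_real_derivative
        2 * a\<^sup>2 / (x\<^sup>2 + a\<^sup>2)) (at x)" by simp
    moreover have "((\<lambda>x. x * ln (x\<^sup>2 + a\<^sup>2) - 2 * x) has_real_derivative
        ln (x\<^sup>2 + a\<^sup>2) + 2 * x\<^sup>2 / (x\<^sup>2 + a\<^sup>2) - 2) (at x)"
      using pos by (auto intro!: derivative_eq_intros simp: power2_eq_square)
    ultimately have "(coulson_primitive a has_real_derivative
        (ln (x\<^sup>2 + a\<^sup>2) + 2 * x\<^sup>2 / (x\<^sup>2 + a\<^sup>2) - 2) + 2 * a\<^sup>2 / (x\<^sup>2 + a\<^sup>2)) (at x)"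
      unfolding coulson_primitive_def by (rule DERIV_add[rotated])
    also have "(ln (x\<^sup>2 + a\<^sup>2) + 2 * x\<^sup>2 / (x\<^sup>2 + a\<^sup>2) - 2) + 2 * a\<^sup>2 / (x\<^sup>2 + a\<^sup>2)
        = ln (x\<^sup>2 + a\<^sup>2)"
    proof -
      have "2 * x\<^sup>2 / (x\<^sup>2 + a\<^sup>2) + 2 * a\<^sup>2 / (x\<^sup>2 + a\<^sup>2) = 2"
        using pos by (simp add: add_divide_distrib[symmetric] divide_eq_eq del: sum_power2_eq_zero_iff)
      then show ?thesis by linarith
    qed
    finally show ?thesis .
  qed
qed

text \<open>For nonzero \<open>a\<close> the primitive is continuous at 0. For \<open>a = 0\<close>
  the logarithm is singular there, but its product with \<open>x\<close> still tends to 0.\<close>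

lemma coulson_primitive_at_0: "(coulson_primitive a \<longlongrightarrow> 0) (at_right 0)"
proof (cases "a = 0")
  case True
  show ?thesis unfolding coulson_primitive_def True by simp real_asymp
next
  case False
  then show ?thesis unfolding coulson_primitive_def by (auto intro!: tendsto_eq_intros)
qed

text \<open>Splitting \<open>2 * ln x\<close> off the logarithm leaves
  \<open>x * ln (1 + (a / x)\<^sup>2)\<close>, which lies between 0 and
  \<open>a\<^sup>2 / x\<close>. The limit comes from the arctangent alone.\<close>

lemma coulson_primitive_at_top:
  "((\<lambda>x. coulson_primitive a x - (2 * x * ln x - 2 * x)) \<longlongrightarrow> pi * \<bar>a\<bar>) at_top"
proof -
  have ln: "((\<lambda>x. x * ln (x\<^sup>2 + a\<^sup>2) - 2 * x * ln x) \<longlongrightarrow> 0) at_top"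
  proof (rule tendsto_sandwich)
    have expand: "x * ln (x\<^sup>2 + a\<^sup>2) - 2 * x * ln x = x * ln (1 + (a / x)\<^sup>2)" if "x > 0" for x
    proof -
      have "x\<^sup>2 + a\<^sup>2 = x\<^sup>2 * (1 + (a / x)\<^sup>2)"
        using that by (simp add: field_simps)
      also have "ln \<dots> = 2 * ln x + ln (1 + (a / x)\<^sup>2)"
        using that by (subst ln_mult_pos) (auto simp: ln_realpow add_pos_nonneg)
      finally show ?thesis by (simp add: algebra_simps)
    qed
    show "\<forall>\<^sub>F x in at_top. 0 \<le> x * ln (x\<^sup>2 + a\<^sup>2) - 2 * x * ln x"
      using eventually_gt_at_top[of 0] by eventually_elim (auto simp: expand)
    show "\<forall>\<^sub>F x in at_top. x * ln (x\<^sup>2 + a\<^sup>2) - 2 * x * ln x \<le> a\<^sup>2 * inverse x"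
      using eventually_gt_at_top[of 0]
    proof eventually_elim
      case (elim x)
      have "x * ln (1 + (a / x)\<^sup>2) \<le> x * (a / x)\<^sup>2"
        using elim by (intro mult_left_mono ln_add_one_self_le_self) auto
      also have "\<dots> = a\<^sup>2 * inverse x" using elim by (simp add: field_simps power2_eq_square)
      finally show ?case using expand[OF elim] by simp
    qed
    show "((\<lambda>x. a\<^sup>2 * inverse x) \<longlongrightarrow> 0) at_top"
      using tendsto_mult[OF tendsto_const[of "a\<^sup>2"] tendsto_inverse_0_at_top[OF filterlim_ident]]
      by simp
  qed simp
  have "((\<lambda>x. 2 * \<bar>a\<bar> * arctan (x / \<bar>a\<bar>)) \<longlongrightarrow> pi * \<bar>a\<bar>) at_top"
  proof (cases "a = 0")
    case False
    have "filterlim (\<lambda>x. x / \<bar>a\<bar>) at_top at_top"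
      using False filterlim_at_top_mult_tendsto_pos[OF tendsto_const[of "1 / \<bar>a\<bar>"] _ filterlim_ident]
      by simp
    then have "((\<lambda>x. arctan (x / \<bar>a\<bar>)) \<longlongrightarrow> pi / 2) at_top"
      by (rule filterlim_compose[OF tendsto_arctan_at_top])
    from tendsto_mult[OF tendsto_const[of "2 * \<bar>a\<bar>"] this] show ?thesis by (simp add: mult_ac)
  qed simp
  from tendsto_add[OF ln this] show ?thesis
    by (simp add: coulson_primitive_def algebra_simps)
qed

text \<open>The difference \<open>G\<close> of the summed primitives is nondecreasing by
  \<open>le\<close> and tends to 0 at both ends of the positive axis, so it is constant and its
  derivative, the difference of the logarithms, vanishes.\<close>

lemma coulson_rigidity:
  fixes L M :: "real multiset"
  assumes size: "size L = size M"
    and le: "\<And>x. x > 0 \<Longrightarrow> (\<Prod>a\<in>#L. x\<^sup>2 + a\<^sup>2) \<le> (\<Prod>a\<in>#M. x\<^sup>2 + a\<^sup>2)"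
    and sum: "(\<Sum>a\<in>#L. \<bar>a\<bar>) = (\<Sum>a\<in>#M. \<bar>a\<bar>)"
    and x: "x > 0"
  shows "(\<Prod>a\<in>#L. x\<^sup>2 + a\<^sup>2) = (\<Prod>a\<in>#M. x\<^sup>2 + a\<^sup>2)"
proof -
  define F where "F L x = (\<Sum>a\<in>#L. coulson_primitive a x)" for L x
  define P where "P L x = (\<Prod>a\<in>#L. x\<^sup>2 + a\<^sup>2)" for L and x :: real
  define G where "G x = F M x - F L x" for x
  have P_pos: "P L x > 0" if "x > 0" for L x
    unfolding P_def by (induction L) (use that in \<open>auto intro!: mult_pos_pos add_pos_nonneg\<close>)
  have F_deriv: "(F L has_real_derivative ln (P L x)) (at x)" if "x > 0" for L x
  proof (induction L)
    case empty
    show ?case by (simp add: F_def P_def)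
  next
    case (add a L)
    have "(x\<^sup>2 + a\<^sup>2) > 0" using that by (simp add: add_pos_nonneg)
    then have ln: "ln (P (add_mset a L) x) = ln (x\<^sup>2 + a\<^sup>2) + ln (P L x)"
      using P_pos[OF that, of L] unfolding P_def by (simp add: ln_mult_pos)
    have F: "F (add_mset a L) = (\<lambda>x. coulson_primitive a x + F L x)"
      by (simp add: F_def fun_eq_iff)
    show ?case
      unfolding ln F by (rule DERIV_add[OF coulson_primitive_deriv[OF that] add.IH])
  qed
  have F_0: "(F L \<longlongrightarrow> 0) (at_right 0)" for L
    unfolding F_def
  proof (induction L)
    case (add a L)
    then show ?case using tendsto_add[OF coulson_primitive_at_0[of a] add.IH] by simp
  qed auto
  have F_top: "((\<lambda>x. F L x - size L * (2 * x * ln x - 2 * x)) \<longlongrightarrow> pi * (\<Sum>a\<in>#L. \<bar>a\<bar>)) at_top" for L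
  proof (induction L)
    case (add a L)
    then show ?case using tendsto_add[OF coulson_primitive_at_top[of a] add.IH]
      by (simp add: F_def algebra_simps)
  qed (simp add: F_def)
  have G_deriv: "(G has_real_derivative ln (P M x) - ln (P L x)) (at x)" if "x > 0" for x
    unfolding G_def by (intro DERIV_diff F_deriv that)
  have G'_nonneg: "ln (P M x) - ln (P L x) \<ge> 0" if "x > 0" for x
    using le[OF that] P_pos[OF that] unfolding P_def by simp
  have mono: "G x \<le> G y" if "0 < x" "x \<le> y" for x y
    by (rule DERIV_nonneg_imp_nondecreasing[OF that(2)])
      (use that G_deriv G'_nonneg in \<open>meson less_le_trans\<close>)
  have G_0: "(G \<longlongrightarrow> 0) (at_right 0)"
    unfolding G_def using tendsto_diff[OF F_0 F_0] by simp
  \<comment> \<open>The divergent terms depend only on the sizes and cancel; the constants that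
    remain cancel by \<open>sum\<close>.\<close>
  have "((\<lambda>x. (F M x - size M * (2 * x * ln x - 2 * x)) - (F L x - size L * (2 * x * ln x - 2 * x)))
      \<longlongrightarrow> 0) at_top"
    using tendsto_diff[OF F_top[of M] F_top[of L]] sum by simp
  then have G_top: "(G \<longlongrightarrow> 0) at_top" unfolding G_def size by simp
  have zero: "G y = 0" if "y > 0" for y
  proof (rule antisym)
    show "G y \<le> 0"
      by (rule tendsto_lowerbound[OF G_top])
        (auto intro!: eventually_at_top_linorderI[of y] mono that)
    have "\<forall>\<^sub>F t in at_right 0. G t \<le> G y"
      using that by (auto simp: eventually_at_right_field intro!: exI[of _ y] mono)
    then show "0 \<le> G y" by (rule tendsto_upperbound[OF G_0]) simp
  qed
  have "(G has_real_derivative 0) (at x)"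
    by (rule has_field_derivative_transform_within_open[of "\<lambda>_. 0" _ _ "{0<..}"])
      (use x zero in auto)
  then have "ln (P M x) - ln (P L x) = 0" using DERIV_unique[OF G_deriv[OF x]] by simp
  then show ?thesis using P_pos[OF x] unfolding P_def by simp
qed

section \<open>Characteristic polynomials of Hermitian matrices\<close>

definition hermitian_mat :: "complex mat \<Rightarrow> bool" where
  "hermitian_mat A \<longleftrightarrow> dim_row A = dim_col A \<and>
     (\<forall>i < dim_row A. \<forall>j < dim_row A. A $$ (i, j) = cnj (A $$ (j, i)))"

text \<open>The Hermitian form \<open>q\<close> of an eigenvector equals \<open>k\<close> times its
  squared norm \<open>N\<close>, and it is its own conjugate by symmetry of
  \<open>A\<close>.\<close>

lemma hermitian_eigenvalue_real:
  assumes "hermitian_mat A" "eigenvalue A k"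
  shows "k \<in> \<real>"
proof -
  define n where "n = dim_row A"
  have A: "A \<in> carrier_mat n n" using assms(1) by (auto simp: hermitian_mat_def n_def)
  have herm: "cnj (A $$ (i, j)) = A $$ (j, i)" if "i < n" "j < n" for i j
    using assms(1) that unfolding hermitian_mat_def n_def by metis
  from assms(2) obtain v where v: "v \<in> carrier_vec n" "v \<noteq> 0\<^sub>v n" "A *\<^sub>v v = k \<cdot>\<^sub>v v"
    unfolding eigenvalue_def eigenvector_def n_def by auto
  define q where "q = (\<Sum>i<n. \<Sum>j<n. cnj (v $ i) * A $$ (i, j) * v $ j)"
  define N where "N = (\<Sum>i<n. (cmod (v $ i))\<^sup>2)"
  have row: "(\<Sum>j<n. A $$ (i, j) * v $ j) = k * v $ i" if "i < n" for i
  proof -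
    have "(A *\<^sub>v v) $ i = (\<Sum>j<n. A $$ (i, j) * v $ j)"
      using that A v(1) by (simp add: scalar_prod_def atLeast0LessThan)
    then show ?thesis using v that by simp
  qed
  have "q = (\<Sum>i<n. cnj (v $ i) * (\<Sum>j<n. A $$ (i, j) * v $ j))"
    unfolding q_def by (simp add: sum_distrib_left mult.assoc)
  also have "\<dots> = (\<Sum>i<n. k * of_real ((cmod (v $ i))\<^sup>2))"
    by (rule sum.cong) (simp_all add: row complex_norm_square del: of_real_power)
  also have "\<dots> = k * of_real N"
    unfolding N_def of_real_sum by (simp only: sum_distrib_left)
  finally have q: "q = k * of_real N" .
  have "cnj q = (\<Sum>i<n. \<Sum>j<n. v $ i * A $$ (j, i) * cnj (v $ j))"
    unfolding q_def by (auto intro!: sum.cong simp: herm)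
  also have "\<dots> = q"
    unfolding q_def by (subst sum.swap) (simp add: mult_ac)
  finally have "cnj k * of_real N = k * of_real N" using q by (metis complex_cnj_complex_of_real complex_cnj_mult)
  moreover have "N \<noteq> 0"
  proof
    assume "N = 0"
    then have "\<forall>i<n. v $ i = 0"
      unfolding N_def by (subst (asm) sum_nonneg_eq_0_iff) auto
    then show False using v(1,2) by (auto intro: eq_vecI)
  qed
  ultimately show ?thesis by (simp add: Reals_cnj_iff)
qed

text \<open>\<open>L\<close> is the multiset of the real eigenvalues; a root \<open>a\<close>
  contributes the squared modulus \<open>x\<^sup>2 + a\<^sup>2\<close> at \<open>\<i> * x\<close>.
  This puts energy and characteristic polynomial into the form used by
  \<open>coulson_rigidity\<close>.\<close>

lemma char_poly_hermitian:
  assumes "hermitian_mat A"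
  obtains L :: "real multiset" where "size L = dim_row A"
    "(\<Sum>k \<in># proots (char_poly A). cmod k) = (\<Sum>a\<in>#L. \<bar>a\<bar>)"
    "\<And>x. (cmod (poly (char_poly A) (\<i> * complex_of_real x)))\<^sup>2 = (\<Prod>a\<in>#L. x\<^sup>2 + a\<^sup>2)"
proof -
  define n where "n = dim_row A"
  have A: "A \<in> carrier_mat n n" using assms by (auto simp: hermitian_mat_def n_def)
  let ?p = "char_poly A"
  have deg: "degree ?p = n" and monic: "lead_coeff ?p = 1"
    using degree_monic_char_poly[OF A] by auto
  then have p0: "?p \<noteq> 0" by auto
  have real: "of_real (Re k) = k" if "k \<in># proots ?p" for k
    using that p0 hermitian_eigenvalue_real[OF assms] eigenvalue_root_char_poly[OF A, of k]
    by (auto simp: of_real_Re)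
  define L where "L = image_mset Re (proots ?p)"
  have roots: "proots ?p = image_mset of_real L"
    unfolding L_def image_mset.compositionality o_def
    by (rule sym, rule image_mset_cong[where g = "\<lambda>x. x", simplified]) (use real in auto)
  have "?p = (\<Prod>k\<in>#proots ?p. [:-k, 1:])"
    using complex_poly_decompose_multiset[of ?p] monic by simp
  then have p: "?p = (\<Prod>a\<in>#L. [:- complex_of_real a, 1:])"
    by (simp add: roots image_mset.compositionality o_def)
  have prod: "(cmod (poly (\<Prod>a\<in>#L. [:- complex_of_real a, 1:]) (\<i> * complex_of_real x)))\<^sup>2
      = (\<Prod>a\<in>#L. x\<^sup>2 + a\<^sup>2)" for x and L :: "real multiset"
  proof (induction L)
    case (add a L)
    have "(cmod (\<i> * of_real x - of_real a))\<^sup>2 = x\<^sup>2 + a\<^sup>2"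
      by (simp add: cmod_power2)
    moreover have "poly (\<Prod>b\<in>#add_mset a L. [:- complex_of_real b, 1:]) (\<i> * of_real x)
      = (\<i> * of_real x - of_real a) * poly (\<Prod>b\<in>#L. [:- complex_of_real b, 1:]) (\<i> * of_real x)"
      by (simp add: algebra_simps)
    ultimately show ?case using add.IH by (simp only: norm_mult power_mult_distrib) simp
  qed auto
  show ?thesis
  proof (rule that)
    show "size L = dim_row A" unfolding L_def using size_proots_complex[of ?p] deg n_def by simp
    show "(\<Sum>k \<in># proots ?p. cmod k) = (\<Sum>a\<in>#L. \<bar>a\<bar>)"
      unfolding roots by (simp add: image_mset.compositionality o_def)
    show "(cmod (poly ?p (\<i> * complex_of_real x)))\<^sup>2 = (\<Prod>a\<in>#L. x\<^sup>2 + a\<^sup>2)" for x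
      unfolding p by (rule prod)
  qed
qed

section \<open>Twisting one edge of a signed graph\<close>

definition skew :: "(nat \<Rightarrow> nat \<Rightarrow> real) \<Rightarrow> bool" where
  "skew w \<longleftrightarrow> (\<forall>i j. w j i = - w i j)"

lemma skewD: "skew w \<Longrightarrow> w j i = - w i j" and skew_diag: "skew w \<Longrightarrow> w i i = 0"
proof -
  assume *: "skew w"
  then show "w j i = - w i j" unfolding skew_def by blast
  have "w i i = - w i i" using * unfolding skew_def by blast
  then show "w i i = 0" by simp
qed

text \<open>An edge is the unordered pair of its ends, so both orientations change sign together and
  skew symmetry survives.\<close>

definition toggle :: "nat set set \<Rightarrow> (nat \<Rightarrow> nat \<Rightarrow> real) \<Rightarrow> nat \<Rightarrow> nat \<Rightarrow> real" where
  "toggle T w i j = (if {i, j} \<in> T then - w i j else w i j)"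

lemma skew_toggle: "skew w \<Longrightarrow> skew (toggle T w)"
proof -
  assume w: "skew w"
  show "skew (toggle T w)"
    unfolding skew_def
  proof (intro allI)
    fix i j :: nat
    have "{j, i} = {i, j}" by blast
    then show "toggle T w j i = - toggle T w i j"
      using skewD[OF w, of j i] by (simp add: toggle_def)
  qed
qed

text \<open>This is the summand of \<open>\<sigma>\<close> in the Leibniz expansion of the
  determinant of x I - w.\<close>

definition leibniz_term :: "nat \<Rightarrow> (nat \<Rightarrow> nat \<Rightarrow> real) \<Rightarrow> real \<Rightarrow> (nat \<Rightarrow> nat) \<Rightarrow> real" where
  "leibniz_term n w x \<sigma> = of_int (sign \<sigma>) * (\<Prod>i<n. (if i = \<sigma> i then x else 0) - w i (\<sigma> i))"

text \<open>
  The coefficient of \<open>z\<close> when the entry \<open>(p, q)\<close> of the matrix is multiplied by \<open>z\<close> and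
  the entry \<open>(q, p)\<close> by its conjugate.  Permutations using both entries contribute
  \<open>z * cnj z = 1\<close> and are therefore excluded.
\<close>

definition arc_sum :: "nat \<Rightarrow> (nat \<Rightarrow> nat \<Rightarrow> real) \<Rightarrow> nat \<Rightarrow> nat \<Rightarrow> real \<Rightarrow> real" where
  "arc_sum n w p q x =
     (\<Sum>\<sigma> | \<sigma> permutes {0..<n} \<and> \<sigma> p = q \<and> \<sigma> q \<noteq> p. leibniz_term n w x \<sigma>)"

text \<open>On the unit circle \<open>cnj z\<close> is the inverse gain; the conjugate keeps the
  matrix Hermitian for every \<open>z\<close>.\<close>

definition twist_mat :: "nat \<Rightarrow> (nat \<Rightarrow> nat \<Rightarrow> real) \<Rightarrow> nat \<Rightarrow> nat \<Rightarrow> complex \<Rightarrow> complex mat" where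
  "twist_mat n w p q z = mat n n (\<lambda>(i, j). \<i> * of_real (w i j) *
     (if i = p \<and> j = q then z else if i = q \<and> j = p then cnj z else 1))"

lemma twist_mat_carrier: "twist_mat n w p q z \<in> carrier_mat n n"
  by (simp add: twist_mat_def)

lemma hermitian_twist_mat: "skew w \<Longrightarrow> p \<noteq> q \<Longrightarrow> hermitian_mat (twist_mat n w p q z)"
  unfolding hermitian_mat_def
proof (intro conjI allI impI)
  fix i j assume w: "skew w" and "p \<noteq> q" "i < dim_row (twist_mat n w p q z)" "j < dim_row (twist_mat n w p q z)"
  moreover obtain u where "w i j = u" "w j i = - u" using skewD[OF w] by blast
  ultimately show "twist_mat n w p q z $$ (i, j) = cnj (twist_mat n w p q z $$ (j, i))"
    by (auto simp: twist_mat_def)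
qed (simp add: twist_mat_def)

text \<open>The diagonal of \<open>w\<close> is zero and the twist is 1 there, so every entry of the
  characteristic matrix at \<open>\<i> * x\<close> is \<open>\<i>\<close> times a real number times
  the twist factor. Each Leibniz product splits accordingly.\<close>

lemma poly_char_poly_twist_mat:
  assumes w: "skew w" and pq: "p \<noteq> q" "p < n" "q < n"
  shows "poly (char_poly (twist_mat n w p q z)) (\<i> * complex_of_real x) = \<i> ^ n *
    (\<Sum>\<sigma> | \<sigma> permutes {0..<n}. of_real (leibniz_term n w x \<sigma>) *
       ((if \<sigma> p = q then z else 1) * (if \<sigma> q = p then cnj z else 1)))"
proof -
  define f where "f i j = (if i = p \<and> j = q then z else if i = q \<and> j = p then cnj z else 1)" for i j
  define B where "B = mat n n (\<lambda>(i, j). \<i> *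
    (of_real ((if i = j then x else 0) - w i j) * f i j))"
  let ?A = "twist_mat n w p q z"
  have "poly (char_poly ?A) (\<i> * of_real x) = det B"
    unfolding char_poly_def
  proof (rule poly_det_cong[of _ n])
    fix i j assume ij: "i < n" "j < n"
    show "poly (char_poly_matrix ?A $$ (i, j)) (\<i> * of_real x) = B $$ (i, j)"
      using ij pq skew_diag[OF w]
      by (auto simp: char_poly_matrix_def twist_mat_def B_def f_def algebra_simps)
  qed (auto simp: B_def twist_mat_carrier)
  also have "det B = (\<Sum>\<sigma> | \<sigma> permutes {0..<n}. of_int (sign \<sigma>) * (\<Prod>i<n. B $$ (i, \<sigma> i)))"
    by (subst det_def'[of _ n]) (auto simp: B_def atLeast0LessThan)
  also have "\<dots> = (\<Sum>\<sigma> | \<sigma> permutes {0..<n}. \<i> ^ n * (of_real (leibniz_term n w x \<sigma>) *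
       ((if \<sigma> p = q then z else 1) * (if \<sigma> q = p then cnj z else 1))))"
  proof (rule sum.cong)
    fix \<sigma> assume "\<sigma> \<in> {\<sigma>. \<sigma> permutes {0..<n}}"
    then have \<sigma>: "\<sigma> permutes {0..<n}" by simp
    then have lt: "\<sigma> i < n" if "i < n" for i
      using permutes_in_image[OF \<sigma>, of i] that by simp
    \<comment> \<open>Only the rows \<open>p\<close> and \<open>q\<close> can carry a twist, so the
      product over all rows collapses to two factors.\<close>
    have f: "f i (\<sigma> i) = (if i = p then (if \<sigma> p = q then z else 1) else 1) *
        (if i = q then (if \<sigma> q = p then cnj z else 1) else 1)" for i
      using pq by (auto simp: f_def)
    have "(\<Prod>i<n. B $$ (i, \<sigma> i)) =
        (\<Prod>i<n. \<i> * (of_real ((if i = \<sigma> i then x else 0) - w i (\<sigma> i)) * f i (\<sigma> i)))"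
      by (rule prod.cong) (auto simp: B_def lt)
    also have "\<dots> = \<i> ^ n * (of_real (\<Prod>i<n. (if i = \<sigma> i then x else 0) - w i (\<sigma> i)) *
        (\<Prod>i<n. f i (\<sigma> i)))"
      by (simp only: prod.distrib prod_constant card_lessThan of_real_prod)
    also have "(\<Prod>i<n. f i (\<sigma> i)) = (if \<sigma> p = q then z else 1) * (if \<sigma> q = p then cnj z else 1)"
      unfolding f prod.distrib using pq by (simp add: prod.delta)
    finally show "of_int (sign \<sigma>) * (\<Prod>i<n. B $$ (i, \<sigma> i)) =
        \<i> ^ n * (of_real (leibniz_term n w x \<sigma>) *
         ((if \<sigma> p = q then z else 1) * (if \<sigma> q = p then cnj z else 1)))"
      by (simp add: leibniz_term_def mult_ac)
  qed simp
  finally show ?thesis by (simp add: sum_distrib_left)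
qed

text \<open>Permutations are grouped by which of the arcs \<open>(p, q)\<close> and
  \<open>(q, p)\<close> they use. Those using both or neither make up \<open>a\<close>, which is the
  same for all unimodular \<open>z\<close> because \<open>z * cnj z = 1\<close>.\<close>

lemma char_poly_twist_mat_decomp:
  assumes w: "skew w" and pq: "p \<noteq> q" "p < n" "q < n"
  obtains a where "\<And>z. cmod z = 1 \<Longrightarrow>
    poly (char_poly (twist_mat n w p q z)) (\<i> * complex_of_real x) =
      \<i> ^ n * (of_real a + of_real (arc_sum n w p q x) * z + of_real (arc_sum n w q p x) * cnj z)"
proof
  fix z :: complex assume z: "cmod z = 1"
  let ?S = "{\<sigma>. \<sigma> permutes {0..<n}}" and ?t = "leibniz_term n w x"
  have fin: "finite ?S" by (simp add: finite_permutations)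
  have arc: "arc_sum n w p q x = (\<Sum>\<sigma>\<in>?S. if \<sigma> p = q \<and> \<sigma> q \<noteq> p then ?t \<sigma> else 0)" for p q
    using sum.inter_filter[OF fin, of ?t "\<lambda>\<sigma>. \<sigma> p = q \<and> \<sigma> q \<noteq> p"] by (simp add: arc_sum_def)
  have zz: "z * cnj z = 1" using z by (simp add: complex_norm_square[symmetric])
  have "(\<Sum>\<sigma>\<in>?S. of_real (?t \<sigma>) * ((if \<sigma> p = q then z else 1) * (if \<sigma> q = p then cnj z else 1)))
    = (\<Sum>\<sigma>\<in>?S. of_real (if \<sigma> p = q \<longleftrightarrow> \<sigma> q = p then ?t \<sigma> else 0)
       + of_real (if \<sigma> p = q \<and> \<sigma> q \<noteq> p then ?t \<sigma> else 0) * z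
       + of_real (if \<sigma> q = p \<and> \<sigma> p \<noteq> q then ?t \<sigma> else 0) * cnj z)"
    by (rule sum.cong) (auto simp: zz)
  also have "\<dots> = of_real (\<Sum>\<sigma>\<in>?S. if \<sigma> p = q \<longleftrightarrow> \<sigma> q = p then ?t \<sigma> else 0)
     + of_real (arc_sum n w p q x) * z + of_real (arc_sum n w q p x) * cnj z"
    unfolding arc by (simp only: sum.distrib sum_distrib_right of_real_sum)
  finally show "poly (char_poly (twist_mat n w p q z)) (\<i> * complex_of_real x) =
      \<i> ^ n * (of_real (\<Sum>\<sigma>\<in>?S. if \<sigma> p = q \<longleftrightarrow> \<sigma> q = p then ?t \<sigma> else 0)
        + of_real (arc_sum n w p q x) * z + of_real (arc_sum n w q p x) * cnj z)"
    unfolding poly_char_poly_twist_mat[OF assms] by simp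
qed

section \<open>Positivity for real skew-symmetric matrices\<close>

lemma poly_char_poly_hermitian_nonzero:
  assumes "hermitian_mat A" "x \<noteq> 0"
  shows "poly (char_poly A) (\<i> * complex_of_real x) \<noteq> 0"
proof -
  obtain L :: "real multiset"
    where "(cmod (poly (char_poly A) (\<i> * complex_of_real x)))\<^sup>2 = (\<Prod>a\<in>#L. x\<^sup>2 + a\<^sup>2)"
    using char_poly_hermitian[OF assms(1)] by metis
  moreover have "(\<Prod>a\<in>#L. x\<^sup>2 + a\<^sup>2) > 0"
    by (induction L) (use assms(2) in \<open>auto intro!: mult_pos_pos add_pos_nonneg\<close>)
  ultimately have "(cmod (poly (char_poly A) (\<i> * complex_of_real x)))\<^sup>2 > 0" by (simp only:)
  then show ?thesis by auto
qed

text \<open>The matrix ix I - iW is \<open>\<i>\<close> times x I - W, and the determinant takes out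
  one factor \<open>\<i>\<close> per row.\<close>

lemma poly_char_poly_imaginary:
  fixes w :: "nat \<Rightarrow> nat \<Rightarrow> real"
  shows "poly (char_poly (mat n n (\<lambda>(i, j). \<i> * of_real (w i j)))) (\<i> * complex_of_real x) =
    \<i> ^ n * of_real (poly (char_poly (mat n n (\<lambda>(i, j). w i j))) x)"
proof -
  let ?C = "mat n n (\<lambda>(i, j). (if i = j then x else 0) - w i j)"
  have "poly (char_poly (mat n n (\<lambda>(i, j). w i j))) x = det ?C"
    unfolding char_poly_def by (rule poly_det_cong[of _ n]) (auto simp: char_poly_matrix_def)
  moreover have "poly (char_poly (mat n n (\<lambda>(i, j). \<i> * of_real (w i j)))) (\<i> * of_real x) =
      det (\<i> \<cdot>\<^sub>m map_mat complex_of_real ?C)"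
    unfolding char_poly_def
    by (rule poly_det_cong[of _ n]) (auto simp: char_poly_matrix_def algebra_simps)
  ultimately show ?thesis by (simp add: of_real_hom.hom_det)
qed

text \<open>A positive root of the characteristic polynomial would give the Hermitian matrix
  \<open>?A\<close> a nonzero imaginary eigenvalue. Being monic, the polynomial is positive far out,
  hence on the whole positive axis by the intermediate value theorem.\<close>

lemma char_poly_skew_pos:
  assumes w: "skew w" and x: "x > 0"
  shows "poly (char_poly (mat n n (\<lambda>(i, j). w i j))) x > 0"
proof -
  let ?W = "mat n n (\<lambda>(i, j). w i j)" and ?A = "mat n n (\<lambda>(i, j). \<i> * complex_of_real (w i j))"
  have W: "?W \<in> carrier_mat n n" by simp
  have "hermitian_mat ?A"
  proof -
    \<comment> \<open>With \<open>z = 1\<close> the twist is trivial for any choice of two distinct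
      indices.\<close>
    have "?A = twist_mat n w 0 1 1" unfolding twist_mat_def by (rule eq_matI) simp_all
    then show ?thesis using hermitian_twist_mat[OF w, of 0 1] by simp
  qed
  then have nz: "poly (char_poly ?W) y \<noteq> 0" if "y > 0" for y
    using poly_char_poly_hermitian_nonzero[of ?A y] poly_char_poly_imaginary[of n w y] that by auto
  have "lead_coeff (char_poly ?W) = 1"
    using degree_monic_char_poly[OF W] by auto
  then obtain b where b: "\<And>y. y \<ge> b \<Longrightarrow> poly (char_poly ?W) y \<ge> 1"
    using poly_pinfty_gt_lc[of "char_poly ?W"] by auto
  show ?thesis
  proof (rule ccontr)
    assume "\<not> ?thesis"
    then have neg: "poly (char_poly ?W) x < 0" using nz[OF x] by simp
    have pos: "poly (char_poly ?W) (max b (x + 1)) > 0" using b[of "max b (x + 1)"] by simp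
    have "x < max b (x + 1)" by simp
    from poly_IVT_pos[OF this neg pos] obtain y where "x < y" "poly (char_poly ?W) y = 0" by auto
    then show False using nz[of y] x by simp
  qed
qed

text \<open>Equality of the two sums of energies suffices, because \<open>coulson_rigidity\<close>
  is applied to the union of the eigenvalue multisets for 1 and -1 and the union of those for
  \<open>\<i>\<close> and \<open>-\<i>\<close>.\<close>

lemma arc_sum_zero_if_equienergetic:
  fixes E :: "complex \<Rightarrow> real"
  assumes E_def: "\<And>z. E z = (\<Sum>k \<in># proots (char_poly (twist_mat n w p q z)). cmod k)"
  assumes w: "skew w" and pq: "p \<noteq> q" "p < n" "q < n"
    and energy: "E 1 + E (-1) = E \<i> + E (-\<i>)"
    and x: "x > 0"
  shows "arc_sum n w p q x = 0"
proof -
  let ?P = "\<lambda>z x. poly (char_poly (twist_mat n w p q z)) (\<i> * complex_of_real x)"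
  have "\<exists>L. size L = n \<and> E z = (\<Sum>a\<in>#L. \<bar>a\<bar>) \<and> (\<forall>x. (cmod (?P z x))\<^sup>2 = (\<Prod>a\<in>#L. x\<^sup>2 + a\<^sup>2))" for z
    using char_poly_hermitian[OF hermitian_twist_mat[OF w pq(1)], of n z] unfolding E_def
    by (metis twist_mat_carrier carrier_matD(1))
  then obtain L where L: "\<And>z. size (L z) = n" "\<And>z. E z = (\<Sum>a\<in>#L z. \<bar>a\<bar>)"
    "\<And>z x. (cmod (?P z x))\<^sup>2 = (\<Prod>a\<in>#L z. x\<^sup>2 + a\<^sup>2)" by metis
  have main: "(\<Prod>a\<in>#L 1 + L (-1). x\<^sup>2 + a\<^sup>2) \<le> (\<Prod>a\<in>#L \<i> + L (-\<i>). x\<^sup>2 + a\<^sup>2) \<and>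
     ((\<Prod>a\<in>#L 1 + L (-1). x\<^sup>2 + a\<^sup>2) = (\<Prod>a\<in>#L \<i> + L (-\<i>). x\<^sup>2 + a\<^sup>2) \<longrightarrow> arc_sum n w p q x = 0)"
    if x: "x > 0" for x
  proof -
    define b c where "b = arc_sum n w p q x" and "c = arc_sum n w q p x"
    obtain a where P: "\<And>z. cmod z = 1 \<Longrightarrow> ?P z x = \<i> ^ n * (of_real a + of_real b * z + of_real c * cnj z)"
      unfolding b_def c_def using char_poly_twist_mat_decomp[OF w pq] by metis
    have P1: "?P 1 x = \<i> ^ n * of_real (a + (b + c))" and Pm1: "?P (-1) x = \<i> ^ n * of_real (a - (b + c))"
      using P[of 1] P[of "-1"] by (simp_all add: algebra_simps)
    have "(cmod (Complex a (b - c)))\<^sup>2 = a\<^sup>2 + (b - c)\<^sup>2" "(cmod (Complex a (c - b)))\<^sup>2 = a\<^sup>2 + (b - c)\<^sup>2"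
      by (simp_all add: cmod_power2 power2_commute)
    moreover have "?P \<i> x = \<i> ^ n * Complex a (b - c)" "?P (-\<i>) x = \<i> ^ n * Complex a (c - b)"
      using P[of \<i>] P[of "-\<i>"] by (simp_all add: complex_eq_iff algebra_simps)
    ultimately have Pi: "(cmod (?P \<i> x))\<^sup>2 = a\<^sup>2 + (b - c)\<^sup>2" "(cmod (?P (-\<i>) x))\<^sup>2 = a\<^sup>2 + (b - c)\<^sup>2"
      by (simp_all add: norm_mult norm_power)
    have cmod_P: "(cmod (?P 1 x))\<^sup>2 = (a + (b + c))\<^sup>2" "(cmod (?P (-1) x))\<^sup>2 = (a - (b + c))\<^sup>2"
      unfolding P1 Pm1 norm_mult norm_power norm_of_real by simp_all
    have prod1: "(\<Prod>y\<in>#L 1 + L (-1). x\<^sup>2 + y\<^sup>2) = (a\<^sup>2 - (b + c)\<^sup>2)\<^sup>2"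
      unfolding image_mset_union prod_mset_Un L(3)[symmetric] cmod_P
      by (simp add: algebra_simps power2_eq_square)
    have prodi: "(\<Prod>y\<in>#L \<i> + L (-\<i>). x\<^sup>2 + y\<^sup>2) = (a\<^sup>2 + (b - c)\<^sup>2)\<^sup>2"
      unfolding image_mset_union prod_mset_Un L(3)[symmetric] Pi by (simp add: power2_eq_square)
    \<comment> \<open>When the twisted matrix is \<open>\<i>\<close> times a real skew matrix
      \<open>v\<close>, the real factor \<open>r\<close> is the characteristic polynomial of
      \<open>v\<close> at \<open>x\<close>.\<close>
    have pos_if: "r > 0" if v: "skew v"
      and tw: "twist_mat n w p q z = mat n n (\<lambda>(i, j). \<i> * of_real (v i j))"
      and r: "?P z x = \<i> ^ n * of_real r" for v z r
    proof -
      have "\<i> ^ n * of_real (poly (char_poly (mat n n (\<lambda>(i, j). v i j))) x) = \<i> ^ n * complex_of_real r"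
        using poly_char_poly_imaginary[of n v x] tw r by (simp only:)
      then have "poly (char_poly (mat n n (\<lambda>(i, j). v i j))) x = r"
        by (simp only: mult_cancel_left of_real_eq_iff) simp
      then show ?thesis using char_poly_skew_pos[OF v x, of n] by simp
    qed
    have pos: "a + (b + c) > 0"
    proof -
      have "twist_mat n w p q 1 = mat n n (\<lambda>(i, j). \<i> * of_real (w i j))"
        unfolding twist_mat_def by (rule eq_matI) simp_all
      then show ?thesis using pos_if[OF w _ P1] by blast
    qed
    have "a - (b + c) > 0"
    proof -
      \<comment> \<open>The twist by -1 is the sign flip of the single edge
        \<open>{p, q}\<close>.\<close>
      let ?v = "toggle {{p, q}} w"
      have if_or: "(if A \<or> B then r else s) = (if A then r else if B then r else s)" for A B and r s :: real
        by simp
      have "?v i j = (if i = p \<and> j = q then - w i j else if i = q \<and> j = p then - w i j else w i j)" for i j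
        unfolding toggle_def singleton_iff doubleton_eq_iff if_or ..
      then have "\<i> * of_real (w i j) * (if i = p \<and> j = q then -1 else if i = q \<and> j = p then cnj (-1) else 1)
          = \<i> * of_real (?v i j)" for i j
        by (simp only: if_distrib[of of_real] if_distrib[of "(*) _"] of_real_minus mult_minus_right
            mult_1_right complex_cnj_minus complex_cnj_one)
      then have "twist_mat n w p q (-1) = mat n n (\<lambda>(i, j). \<i> * of_real (?v i j))"
        unfolding twist_mat_def by presburger
      then show ?thesis by (rule pos_if[OF skew_toggle[OF w] _ Pm1])
    qed
    with pos have "(a + (b + c)) * (a - (b + c)) > 0" by (rule mult_pos_pos)
    then have nonneg: "a\<^sup>2 - (b + c)\<^sup>2 > 0" by (simp add: algebra_simps power2_eq_square)
    have le: "a\<^sup>2 - (b + c)\<^sup>2 \<le> a\<^sup>2 + (b - c)\<^sup>2"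
      using zero_le_power2[of "b + c"] zero_le_power2[of "b - c"] by linarith
    have "b = 0" if "(a\<^sup>2 - (b + c)\<^sup>2)\<^sup>2 = (a\<^sup>2 + (b - c)\<^sup>2)\<^sup>2"
    proof -
      have "a\<^sup>2 - (b + c)\<^sup>2 = a\<^sup>2 + (b - c)\<^sup>2"
        using that nonneg le by (intro power2_eq_imp_eq[OF that]) auto
      then have "(b + c)\<^sup>2 + (b - c)\<^sup>2 = 0" by linarith
      then have "b + c = 0 \<and> b - c = 0" by (simp only: sum_power2_eq_zero_iff)
      then show ?thesis by simp
    qed
    moreover have "(a\<^sup>2 - (b + c)\<^sup>2)\<^sup>2 \<le> (a\<^sup>2 + (b - c)\<^sup>2)\<^sup>2"
      using nonneg le by (intro power_mono) auto
    ultimately show ?thesis unfolding prod1 prodi b_def[symmetric] by blast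
  qed
  have "(\<Prod>a\<in>#L 1 + L (-1). x\<^sup>2 + a\<^sup>2) = (\<Prod>a\<in>#L \<i> + L (-\<i>). x\<^sup>2 + a\<^sup>2)"
    by (rule coulson_rigidity) (use L(1,2) energy main x in auto)
  then show ?thesis using main[OF x] by blast
qed

section \<open>Alternating sums over sign flips\<close>

text \<open>This is the factor acquired by the Leibniz term of \<open>\<sigma>\<close> when the sign
  of \<open>e\<close> is flipped. A two-element \<open>e\<close> traversed in both directions
  contributes two sign changes, which cancel.\<close>

definition edge_sign :: "nat \<Rightarrow> (nat \<Rightarrow> nat) \<Rightarrow> nat set \<Rightarrow> real" where
  "edge_sign n \<sigma> e = (\<Prod>i<n. if {i, \<sigma> i} = e then -1 else 1)"

lemma edge_sign_eq_1: "(\<And>i. {i, \<sigma> i} \<noteq> e) \<Longrightarrow> edge_sign n \<sigma> e = 1"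
  unfolding edge_sign_def by (rule prod.neutral) simp

text \<open>A fixed point \<open>i\<close> corresponds to the singleton \<open>{i}\<close>, which
  \<open>T\<close> excludes; thus the summand \<open>x\<close> is never affected and each factor as
  a whole is multiplied by its sign.\<close>

lemma leibniz_term_toggle:
  assumes T: "finite T" "\<And>i. {i} \<notin> T"
  shows "leibniz_term n (toggle T w) x \<sigma> = leibniz_term n w x \<sigma> * (\<Prod>e\<in>T. edge_sign n \<sigma> e)"
proof -
  have "(\<Prod>e\<in>T. if {i, \<sigma> i} = e then -1 else 1) = (if {i, \<sigma> i} \<in> T then -1 else 1 :: real)" for i
    using T(1) by (simp add: prod.delta)
  then have "(\<Prod>e\<in>T. edge_sign n \<sigma> e) = (\<Prod>i<n. if {i, \<sigma> i} \<in> T then -1 else 1)"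
    unfolding edge_sign_def by (subst prod.swap) simp
  moreover have "(if i = \<sigma> i then x else 0) - toggle T w i (\<sigma> i)
      = ((if i = \<sigma> i then x else 0) - w i (\<sigma> i)) * (if {i, \<sigma> i} \<in> T then -1 else 1)" for i
    using T(2)[of i] by (auto simp: toggle_def)
  ultimately show ?thesis by (simp add: leibniz_term_def prod.distrib)
qed

text \<open>
  The factor \<open>1 - edge_sign n \<sigma> e\<close> vanishes unless \<open>\<sigma>\<close> traverses the edge \<open>e\<close> in exactly one
  direction, so the alternating sum filters the permutations which do so for every edge in \<open>E\<close>.
\<close>

lemma alternating_arc_sum:
  assumes E: "finite E" "\<And>i. {i} \<notin> E"
  shows "(\<Sum>T\<in>Pow E. (\<Prod>e\<in>T. -1) * arc_sum n (toggle T w) p q x) =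
    (\<Sum>\<sigma> | \<sigma> permutes {0..<n} \<and> \<sigma> p = q \<and> \<sigma> q \<noteq> p.
      leibniz_term n w x \<sigma> * (\<Prod>e\<in>E. 1 - edge_sign n \<sigma> e))"
proof -
  have "(\<Sum>T\<in>Pow E. (\<Prod>e\<in>T. -1) * leibniz_term n (toggle T w) x \<sigma>) =
      leibniz_term n w x \<sigma> * (\<Prod>e\<in>E. 1 - edge_sign n \<sigma> e)" for \<sigma>
  proof -
    have "(\<Sum>T\<in>Pow E. (\<Prod>e\<in>T. -1) * leibniz_term n (toggle T w) x \<sigma>)
        = (\<Sum>T\<in>Pow E. leibniz_term n w x \<sigma> * (\<Prod>e\<in>T. - edge_sign n \<sigma> e))"
    proof (rule sum.cong)
      fix T assume "T \<in> Pow E"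
      then have "finite T" "\<And>i. {i} \<notin> T" using E by (auto intro: finite_subset)
      then show "(\<Prod>e\<in>T. -1) * leibniz_term n (toggle T w) x \<sigma> =
          leibniz_term n w x \<sigma> * (\<Prod>e\<in>T. - edge_sign n \<sigma> e)"
        using prod.distrib[of "\<lambda>_. -1" "edge_sign n \<sigma>" T]
        by (simp add: leibniz_term_toggle mult_ac del: prod_constant)
    qed simp
    \<comment> \<open>Read backwards, this expands a product of binomials over the subsets of
      \<open>E\<close>.\<close>
    also have "\<dots> = leibniz_term n w x \<sigma> * (\<Prod>e\<in>E. - edge_sign n \<sigma> e + 1)"
      by (subst prod_add[OF E(1)]) (simp add: sum_distrib_left)
    finally show ?thesis by simp
  qed
  then show ?thesis
    unfolding arc_sum_def sum_distrib_left by (subst sum.swap) simp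
qed

text \<open>The diagonal of a skew \<open>w\<close> is zero, so each fixed point contributes exactly
  \<open>x\<close>.\<close>

lemma leibniz_term_monomial:
  assumes "skew w"
  shows "leibniz_term n w x \<sigma> =
    (of_int (sign \<sigma>) * (\<Prod>i | i < n \<and> \<sigma> i \<noteq> i. - w i (\<sigma> i))) * x ^ card {i. i < n \<and> \<sigma> i = i}"
proof -
  have "(\<Prod>i<n. (if i = \<sigma> i then x else 0) - w i (\<sigma> i))
      = (\<Prod>i<n. if \<sigma> i = i then x else - w i (\<sigma> i))"
    by (rule prod.cong) (auto simp: skew_diag[OF assms])
  also have "\<dots> = (\<Prod>i\<in>{..<n} \<inter> {i. \<sigma> i = i}. x) * (\<Prod>i\<in>{..<n} \<inter> - {i. \<sigma> i = i}. - w i (\<sigma> i))"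
    by (rule prod.If_cases) simp
  also have "{..<n} \<inter> {i. \<sigma> i = i} = {i. i < n \<and> \<sigma> i = i}" by auto
  also have "{..<n} \<inter> - {i. \<sigma> i = i} = {i. i < n \<and> \<sigma> i \<noteq> i}" by auto
  finally show ?thesis by (simp add: leibniz_term_def)
qed

definition cycle_edges :: "nat list \<Rightarrow> nat set set" where
  "cycle_edges cs = (\<lambda>k. {cs ! k, cs ! (Suc k mod length cs)}) ` {..<length cs}"

section \<open>The rotation along a cycle\<close>

context
  fixes cs :: "nat list" and n :: nat
  assumes dist: "distinct cs" and len: "3 \<le> length cs" and sub: "set cs \<subseteq> {0..<n}"
begin

lemma mod_length_less: "k mod length cs < length cs"
  using len by (intro mod_less_divisor) linarith

lemma cycle_of_list_nth:
  assumes "k < length cs"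
  shows "cycle_of_list cs (cs ! k) = cs ! (Suc k mod length cs)"
proof -
  have "map (cycle_of_list cs ^^ 1) cs ! k = rotate 1 cs ! k"
    using cyclic_rotation[OF dist, of 1] by simp
  then show ?thesis using assms by (simp add: nth_rotate del: rotate_Suc)
qed

lemma rotation_permutes: "cycle_of_list cs permutes {0..<n}"
  using cycle_permutes[of cs] sub by (rule permutes_subset)

lemma moved_by_rotation: "{i. i < n \<and> cycle_of_list cs i \<noteq> i} = set cs"
proof (intro equalityI subsetI)
  fix i assume "i \<in> {i. i < n \<and> cycle_of_list cs i \<noteq> i}"
  then show "i \<in> set cs" using id_outside_supp[of i cs] by auto
next
  fix i assume "i \<in> set cs"
  then obtain k where k: "k < length cs" "i = cs ! k" by (auto simp: in_set_conv_nth)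
  have "Suc k mod length cs \<noteq> k" using len k(1) by (simp add: mod_Suc)
  then have "cs ! (Suc k mod length cs) \<noteq> cs ! k"
    using dist k(1) len by (subst nth_eq_iff_index_eq) (auto simp: mod_length_less)
  then show "i \<in> {i. i < n \<and> cycle_of_list cs i \<noteq> i}"
    using k cycle_of_list_nth[OF k(1)] sub by (auto simp: subset_iff)
qed

text \<open>Two steps along a cycle of length at least 3 do not return to the start. This rules out
  walking an edge back and forth.\<close>

lemma nth_succ_succ:
  assumes "k < length cs"
  shows "cs ! (Suc (Suc k mod length cs) mod length cs) \<noteq> cs ! k"
proof -
  have "Suc (Suc k mod length cs) mod length cs \<noteq> k"
    using len assms by (auto simp: mod_Suc)
  then show ?thesis using dist assms len by (subst nth_eq_iff_index_eq) (auto simp: mod_length_less)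
qed

lemma edge_sign_rotation:
  assumes "e \<in> cycle_edges cs"
  shows "edge_sign n (cycle_of_list cs) e = -1"
proof -
  obtain k where k: "k < length cs" "e = {cs ! k, cs ! (Suc k mod length cs)}"
    using assms by (auto simp: cycle_edges_def)
  let ?\<tau> = "cycle_of_list cs"
  \<comment> \<open>The opposite orientation would require the rotation to return to
    \<open>cs ! k\<close> after two steps.\<close>
  have "{i, ?\<tau> i} = e \<longleftrightarrow> i = cs ! k" for i
    using cycle_of_list_nth[OF k(1)] cycle_of_list_nth[OF mod_length_less[of "Suc k"]] nth_succ_succ[OF k(1)]
    unfolding k(2) by (auto simp: doubleton_eq_iff)
  moreover have "cs ! k < n" using k(1) sub by (auto simp: subset_iff)
  ultimately show ?thesis unfolding edge_sign_def by (simp add: prod.delta)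
qed

text \<open>An edge sign other than 1 forces \<open>\<sigma>\<close> to traverse the edge. Starting
  from the first arc, injectivity excludes the backward direction at each edge, so
  \<open>\<sigma>\<close> follows the whole cycle. The number of fixed points then leaves no other
  vertex to be moved.\<close>

lemma rotation_unique:
  assumes \<sigma>: "\<sigma> permutes {0..<n}" "\<sigma> (cs ! 0) = cs ! 1"
    and E: "\<And>e. e \<in> cycle_edges cs \<Longrightarrow> edge_sign n \<sigma> e \<noteq> 1"
    and card: "card {i. i < n \<and> \<sigma> i = i} = n - length cs"
  shows "\<sigma> = cycle_of_list cs"
proof -
  have step: "\<sigma> (cs ! k) = cs ! (Suc k mod length cs)" if "k < length cs" for k
    using that
  proof (induction k)
    case 0
    then show ?case using \<sigma>(2) len by simp
  next
    case (Suc k)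
    then have IH: "\<sigma> (cs ! k) = cs ! Suc k" by simp
    have "{cs ! Suc k, cs ! (Suc (Suc k) mod length cs)} \<in> cycle_edges cs"
      using Suc.prems by (auto simp: cycle_edges_def)
    from E[OF this] obtain i where "{i, \<sigma> i} = {cs ! Suc k, cs ! (Suc (Suc k) mod length cs)}"
      using edge_sign_eq_1 by blast
    then consider "i = cs ! Suc k" "\<sigma> i = cs ! (Suc (Suc k) mod length cs)"
      | "i = cs ! (Suc (Suc k) mod length cs)" "\<sigma> i = cs ! Suc k"
      by (auto simp: doubleton_eq_iff)
    then show ?case
    proof cases
      case 1
      then show ?thesis by simp
    next
      case 2
      \<comment> \<open>Both \<open>cs ! k\<close> and the vertex two steps later would be mapped to
        \<open>cs ! Suc k\<close>.\<close>
      then have "cs ! (Suc (Suc k) mod length cs) = cs ! k"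
        using IH permutes_inj[OF \<sigma>(1)] by (metis injD)
      then show ?thesis using nth_succ_succ[of k] Suc.prems by simp
    qed
  qed
  then have on: "\<sigma> i = cycle_of_list cs i" if "i \<in> set cs" for i
    using that cycle_of_list_nth by (auto simp: in_set_conv_nth)
  have moved: "{i. i < n \<and> \<sigma> i \<noteq> i} = {0..<n} - {i. i < n \<and> \<sigma> i = i}" by auto
  then have "card {i. i < n \<and> \<sigma> i \<noteq> i} = n - (n - length cs)"
    unfolding moved using card by (subst card_Diff_subset) auto
  also have "\<dots> = card (set cs)"
    using card_mono[OF _ sub] distinct_card[OF dist] by simp
  finally have "set cs = {i. i < n \<and> \<sigma> i \<noteq> i}"
    using moved_by_rotation on by (intro card_subset_eq) auto
  then have "\<sigma> i = i" if "i \<notin> set cs" for i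
    using that permutes_not_in[OF \<sigma>(1), of i] by (cases "i < n") auto
  then show ?thesis using on id_outside_supp by (metis ext)
qed

text \<open>If all these arc sums vanished for positive \<open>x\<close>, their alternating sum over
  the flips would be the zero polynomial \<open>P\<close>. Its coefficient of degree
  \<open>n - length cs\<close> comes from the rotation alone and is nonzero.\<close>

lemma arc_sum_toggle_nonzero:
  assumes w: "skew w" and nz: "\<And>k. k < length cs \<Longrightarrow> w (cs ! k) (cs ! (Suc k mod length cs)) \<noteq> 0"
  shows "\<exists>T. \<exists>x>0. arc_sum n (toggle T w) (cs ! 0) (cs ! 1) x \<noteq> 0"
proof (rule ccontr)
  assume "\<not> ?thesis"
  then have zero: "arc_sum n (toggle T w) (cs ! 0) (cs ! 1) x = 0" if "x > 0" for T x
    using that by metis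
  let ?E = "cycle_edges cs" and ?\<tau> = "cycle_of_list cs"
  define B where "B = {\<sigma>. \<sigma> permutes {0..<n} \<and> \<sigma> (cs ! 0) = cs ! 1 \<and> \<sigma> (cs ! 1) \<noteq> cs ! 0}"
  define \<kappa> where "\<kappa> \<sigma> = (of_int (sign \<sigma>) * (\<Prod>i | i < n \<and> \<sigma> i \<noteq> i. - w i (\<sigma> i))) *
    (\<Prod>e\<in>?E. 1 - edge_sign n \<sigma> e)" for \<sigma>
  define P where "P = (\<Sum>\<sigma>\<in>B. monom (\<kappa> \<sigma>) (card {i. i < n \<and> \<sigma> i = i}))"
  have finB: "finite B" unfolding B_def by (rule finite_subset[OF _ finite_permutations[of "{0..<n}"]]) auto
  have finE: "finite ?E" by (simp add: cycle_edges_def)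
  have E1: "{i} \<notin> ?E" for i
  proof
    assume "{i} \<in> ?E"
    then obtain k where k: "k < length cs" "cs ! k = cs ! (Suc k mod length cs)"
      by (auto simp: cycle_edges_def doubleton_eq_iff)
    then have "?\<tau> (cs ! k) = cs ! k" using cycle_of_list_nth[OF k(1)] by metis
    then show False using moved_by_rotation k(1) nth_mem by blast
  qed
  have "poly P x = 0" if "x > 0" for x
  proof -
    have "poly P x = (\<Sum>\<sigma>\<in>B. leibniz_term n w x \<sigma> * (\<Prod>e\<in>?E. 1 - edge_sign n \<sigma> e))"
      unfolding P_def poly_sum poly_monom \<kappa>_def leibniz_term_monomial[OF w]
      by (simp add: mult_ac)
    also have "\<dots> = 0"
      unfolding B_def alternating_arc_sum[OF finE E1, symmetric] using zero[OF that] by simp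
    finally show ?thesis .
  qed
  then have "{0<..} \<subseteq> {x. poly P x = 0}" by auto
  then have "P = 0" using poly_roots_finite[of P] infinite_Ioi[of "0::real"] finite_subset by blast
  \<comment> \<open>In this degree a permutation containing the cycle fixes every vertex off the cycle.\<close>
  then have "0 = coeff P (n - length cs)" by simp
  also have "\<dots> = (\<Sum>\<sigma>\<in>B. if \<sigma> = ?\<tau> then \<kappa> \<sigma> else 0)"
    unfolding P_def coeff_sum coeff_monom
  proof (rule sum.cong)
    fix \<sigma> assume \<sigma>: "\<sigma> \<in> B"
    have fix_\<tau>: "card {i. i < n \<and> ?\<tau> i = i} = n - length cs"
    proof -
      have "{i. i < n \<and> ?\<tau> i = i} = {0..<n} - set cs"
        unfolding moved_by_rotation[symmetric] by auto
      then show ?thesis using sub distinct_card[OF dist] by (simp add: card_Diff_subset)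
    qed
    have "\<kappa> \<sigma> = 0" if "card {i. i < n \<and> \<sigma> i = i} = n - length cs" "\<sigma> \<noteq> ?\<tau>"
    proof -
      from that \<sigma> obtain e where "e \<in> ?E" "edge_sign n \<sigma> e = 1"
        using rotation_unique[of \<sigma>] unfolding B_def by auto
      then show ?thesis using finE by (auto simp: \<kappa>_def prod_zero_iff)
    qed
    then show "(if card {i. i < n \<and> \<sigma> i = i} = n - length cs then \<kappa> \<sigma> else 0) =
        (if \<sigma> = ?\<tau> then \<kappa> \<sigma> else 0)"
      using fix_\<tau> by auto
  qed simp
  also have "\<dots> = \<kappa> ?\<tau>"
  proof -
    have "cs \<noteq> []" using len by auto
    then have "?\<tau> (cs ! 0) = cs ! 1" using cycle_of_list_nth[of 0] len by simp
    moreover have "?\<tau> (cs ! 1) \<noteq> cs ! 0"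
      using cycle_of_list_nth[of 1] nth_succ_succ[of 0] len \<open>cs \<noteq> []\<close> by simp
    ultimately have "?\<tau> \<in> B" unfolding B_def using rotation_permutes by simp
    then show ?thesis using finB by simp
  qed
  finally have "\<kappa> ?\<tau> = 0" by simp
  moreover have "(\<Prod>i | i < n \<and> ?\<tau> i \<noteq> i. - w i (?\<tau> i)) \<noteq> 0"
    unfolding moved_by_rotation using nz cycle_of_list_nth
    by (auto simp: prod_zero_iff in_set_conv_nth)
  \<comment> \<open>The rotation has edge sign -1 on the cycle, so every factor is 2.\<close>
  moreover have "(\<Prod>e\<in>?E. 1 - edge_sign n ?\<tau> e) \<noteq> 0"
    using finE edge_sign_rotation by (auto simp: prod_zero_iff)
  moreover have "of_int (sign ?\<tau>) \<noteq> (0::real)" by (simp add: sign_def)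
  ultimately show False unfolding \<kappa>_def by simp
qed

end

section \<open>Gain graphs\<close>

text \<open>The gain of an arc is the entry of \<open>f\<close> at the positions of its ends;
  \<open>restrict\<close> makes the gain function extensional, as \<open>gain_graphs_on\<close>
  demands.\<close>

lemma gain_graph_with_adjacency_matrix:
  assumes G: "pair_graph G" and vs: "distinct vs" "set vs = pverts G"
    and unit: "\<And>i j. (vs ! i, vs ! j) \<in> parcs G \<Longrightarrow> cmod (f i j) = 1 \<and> f j i = cnj (f i j)"
    and zero: "\<And>i j. (vs ! i, vs ! j) \<notin> parcs G \<Longrightarrow> f i j = 0"
  shows "\<exists>\<Phi>\<in>gain_graphs_on G. adjacency_matrix vs \<Phi> = mat (length vs) (length vs) (\<lambda>(i, j). f i j)"
proof -
  interpret pair_graph G by (rule G)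
  define idx where "idx = the_inv_into {..<length vs} ((!) vs)"
  have idx: "idx (vs ! i) = i" if "i < length vs" for i
    unfolding idx_def using that vs(1) by (intro the_inv_into_f_f) (auto simp: inj_on_nth)
  define \<phi> where "\<phi> = restrict (\<lambda>(u, v). f (idx u) (idx v)) (parcs G)"
  have arc: "\<exists>i j. u = vs ! i \<and> v = vs ! j \<and> i < length vs \<and> j < length vs" if "(u, v) \<in> parcs G" for u v
    using arc_fst_in_verts[OF that] arc_snd_in_verts[OF that] vs(2)
    by (metis fst_conv snd_conv in_set_conv_nth)
  have "\<phi> (u, v) \<in> {z. cmod z = 1} \<and> \<phi> (u, v) = inverse (\<phi> (v, u))" if uv: "(u, v) \<in> parcs G" for u v
  proof -
    obtain i j where ij: "u = vs ! i" "v = vs ! j" "i < length vs" "j < length vs"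
      using arc[OF uv] by blast
    have "f i j * f j i = 1" "cmod (f i j) = 1"
      using unit[of i j] uv unfolding ij(1,2) by (simp_all add: complex_norm_square[symmetric])
    \<comment> \<open>For unimodular entries the conjugate is the inverse.\<close>
    then have "f i j = inverse (f j i)" by (metis inverse_unique mult.commute)
    then show ?thesis
      using uv arcs_symmetric[OF uv] \<open>cmod (f i j) = 1\<close> ij by (simp add: \<phi>_def idx)
  qed
  then have "(G, \<phi>) \<in> gain_graphs_on G"
    unfolding gain_graphs_on_def by (auto simp: \<phi>_def)
  moreover have "adjacency_matrix vs (G, \<phi>) = mat (length vs) (length vs) (\<lambda>(i, j). f i j)"
    unfolding adjacency_matrix_def by (rule eq_matI) (auto simp: \<phi>_def idx zero)
  ultimately show ?thesis by blast
qed

section \<open>From directed cycles to cyclic vertex lists\<close>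

lemma cas_arcs:
  assumes "pre_digraph.cas (with_proj G) u p v" "p \<noteq> []"
  shows "fst (p ! 0) = u \<and> snd (last p) = v \<and> (\<forall>k. Suc k < length p \<longrightarrow> fst (p ! Suc k) = snd (p ! k))"
  using assms
proof (induction p arbitrary: u)
  case (Cons e p)
  show ?case
  proof (cases "p = []")
    case True
    then show ?thesis using Cons.prems by (simp add: pre_digraph.cas.simps)
  next
    case False
    then show ?thesis using Cons.prems Cons.IH[of "snd e"]
      by (auto simp: pre_digraph.cas.simps nth_Cons split: nat.split)
  qed
qed simp

text \<open>The vertex list of a closed walk repeats its starting point; its tail, the list of heads
  of the arcs, names each vertex of the cycle once. The arc after the one ending in a head leads to
  the next head, cyclically.\<close>

lemma cycle_vertices:
  assumes cyc: "pre_digraph.cycle (with_proj G) p"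
  shows "distinct (map snd p)"
    and "\<And>k. k < length p \<Longrightarrow> (map snd p ! k, map snd p ! (Suc k mod length p)) \<in> parcs G"
proof -
  obtain u where u: "pre_digraph.awalk (with_proj G) u p u"
      "distinct (tl (pre_digraph.awalk_verts (with_proj G) u p))" "p \<noteq> []"
    using cyc unfolding pre_digraph.cycle_def by blast
  have cas: "pre_digraph.cas (with_proj G) u p u" and arcs: "set p \<subseteq> parcs G"
    using u(1) unfolding pre_digraph.awalk_def by simp_all
  show "distinct (map snd p)"
    using u(2,3) by (simp add: pre_digraph.awalk_verts_conv'[OF cas])
  fix k assume k: "k < length p"
  have "Suc k mod length p < length p" using u(3) by simp
  then have "p ! (Suc k mod length p) \<in> parcs G" using arcs nth_mem by blast
  moreover have "fst (p ! (Suc k mod length p)) = snd (p ! k)"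
  proof (cases "Suc k < length p")
    case True
    then show ?thesis using cas_arcs[OF cas u(3)] by simp
  next
    case False
    then have "length p = Suc k" using k by simp
    then show ?thesis using cas_arcs[OF cas u(3)] u(3) by (simp add: last_conv_nth)
  qed
  ultimately show "(map snd p ! k, map snd p ! (Suc k mod length p)) \<in> parcs G"
    using k \<open>Suc k mod length p < length p\<close> by (metis nth_map prod.collapse)
qed

theorem theorem5p2:
  fixes G :: "'a pair_pre_digraph" and vs :: "'a list"
  assumes "pair_graph G"
    and "distinct vs" and "set vs = pverts G"
    and "graph_cycles G \<noteq> {}"
    and "pairwise (\<lambda>C D. disjnt (pverts C) (pverts D)) (graph_cycles G)"
  shows "\<not> equienergetic vs (gain_graphs_on G)"
proof
  assume equi: "equienergetic vs (gain_graphs_on G)"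
  interpret pair_graph G by (rule assms(1))
  define n where "n = length vs"
  obtain c where c: "pre_digraph.cycle (with_proj G) c" "3 \<le> length c"
    using assms(4) unfolding graph_cycles_def by blast
  note c_arc = cycle_vertices(2)[OF c(1)]
  have "\<exists>i<n. vs ! i = snd (c ! k)" if "k < length c" for k
    using arc_fst_in_verts[OF c_arc[OF that]] that assms(3) by (auto simp: in_set_conv_nth n_def)
  then obtain idx where idx: "\<And>k. k < length c \<Longrightarrow> idx k < n \<and> vs ! idx k = snd (c ! k)" by metis
  \<comment> \<open>The cycle is transported to the positions of its vertices in
    \<open>vs\<close>.\<close>
  define cs where "cs = map idx [0..<length c]"
  have len: "length cs = length c" by (simp add: cs_def)
  have cs: "cs ! k < n" "vs ! (cs ! k) = map snd c ! k" if "k < length c" for k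
    using idx[OF that] that by (simp_all add: cs_def)
  have dist: "distinct cs"
    unfolding distinct_conv_nth len
  proof (intro allI impI)
    fix i j assume "i < length c" "j < length c" "i \<noteq> j"
    then show "cs ! i \<noteq> cs ! j"
      using cs(2)[of i] cs(2)[of j] cycle_vertices(1)[OF c(1)]
      by (metis distinct_conv_nth length_map)
  qed
  have sub: "set cs \<subseteq> {0..<n}" using cs(1) by (auto simp: in_set_conv_nth len)
  \<comment> \<open>Each edge is signed by the order of the positions of its ends, which makes
    \<open>w\<close> skew.\<close>
  define w :: "nat \<Rightarrow> nat \<Rightarrow> real"
    where "w i j = (if (vs ! i, vs ! j) \<in> parcs G then if i < j then 1 else -1 else 0)" for i j
  have sym: "(u, v) \<in> parcs G \<longleftrightarrow> (v, u) \<in> parcs G" for u v using arcs_symmetric by blast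
  have irrefl: "(u, u) \<notin> parcs G" for u using pair_no_loops by fastforce
  have skew: "skew w"
    unfolding skew_def w_def
  proof (intro allI)
    fix i j :: nat
    consider "i < j" | "i = j" | "j < i" by linarith
    then show "(if (vs ! j, vs ! i) \<in> parcs G then if j < i then 1 else - 1 else 0) =
        - (if (vs ! i, vs ! j) \<in> parcs G then if i < j then 1 else - 1 else (0::real))"
      by cases (simp_all add: sym[of "vs ! i" "vs ! j"] irrefl)
  qed
  let ?p = "cs ! 0" and ?q = "cs ! 1"
  have "c \<noteq> []" using c(2) by auto
  then have pq: "?p \<noteq> ?q" "?p < n" "?q < n"
    using nth_eq_iff_index_eq[OF dist, of 0 1] cs(1)[of 0] cs(1)[of 1] len c(2) by simp_all
  have w_nz: "w (cs ! k) (cs ! (Suc k mod length cs)) \<noteq> 0" if "k < length cs" for k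
  proof -
    have k: "k < length c" using that len by simp
    have "Suc k mod length c < length c" using c(2) by (intro mod_less_divisor) linarith
    then show ?thesis using c_arc[OF k] cs(2)[OF k] cs(2)[of "Suc k mod length c"]
      by (simp add: w_def len)
  qed
  \<comment> \<open>All sign flips and all unimodular twists stay within the gain graphs on
    \<open>G\<close>, so equienergeticity applies to them.\<close>
  have realize: "\<exists>\<Phi>\<in>gain_graphs_on G. adjacency_matrix vs \<Phi> = twist_mat n (toggle T w) ?p ?q z"
    if z: "cmod z = 1" for T z
  proof -
    let ?f = "\<lambda>i j. \<i> * complex_of_real (toggle T w i j) *
      (if i = ?p \<and> j = ?q then z else if i = ?q \<and> j = ?p then cnj z else 1)"
    have herm: "?f j i = cnj (?f i j)" for i j
    proof -
      obtain u where "toggle T w i j = u" "toggle T w j i = - u"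
        using skewD[OF skew_toggle[OF skew]] by blast
      then show ?thesis using pq(1) by auto
    qed
    have zero: "?f i j = 0" if "(vs ! i, vs ! j) \<notin> parcs G" for i j
    proof -
      have "toggle T w i j = 0" using that by (simp add: toggle_def w_def)
      then show ?thesis by (simp only: of_real_0 mult_zero_right mult_zero_left)
    qed
    have unit: "cmod (?f i j) = 1" if "(vs ! i, vs ! j) \<in> parcs G" for i j
    proof -
      have "\<bar>toggle T w i j\<bar> = 1" using that by (simp add: toggle_def w_def)
      moreover have "cmod (if i = ?p \<and> j = ?q then z else if i = ?q \<and> j = ?p then cnj z else 1) = 1"
        using z by simp
      ultimately show ?thesis by (simp only: norm_mult norm_ii norm_of_real mult_1)
    qed
    have "\<exists>\<Phi>\<in>gain_graphs_on G. adjacency_matrix vs \<Phi> = mat n n (\<lambda>(i, j). ?f i j)"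
      unfolding n_def
      by (rule gain_graph_with_adjacency_matrix[where f = ?f, OF assms(1-3)])
        (use herm unit zero in blast)+
    then show ?thesis unfolding twist_mat_def .
  qed
  have energy: "(\<Sum>k \<in># proots (char_poly (twist_mat n (toggle T w) ?p ?q z)). cmod k) =
      (\<Sum>k \<in># proots (char_poly (twist_mat n (toggle T w) ?p ?q z')). cmod k)"
    if "cmod z = 1" "cmod z' = 1" for T z z'
    using realize[OF that(1), of T] realize[OF that(2), of T] equi
    unfolding equienergetic_def energy_def by metis
  \<comment> \<open>Here \<open>refl\<close> instantiates \<open>E\<close> with the energy of the
    twisted matrix as a function of \<open>z\<close>.\<close>
  have "arc_sum n (toggle T w) ?p ?q x = 0" if "x > 0" for T x
    by (rule arc_sum_zero_if_equienergetic[OF refl skew_toggle[OF skew] pq _ that])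
      (use energy[of 1 \<i>] energy[of "-1" "-\<i>"] in simp)
  moreover have "3 \<le> length cs" using c(2) len by simp
  ultimately show False using arc_sum_toggle_nonzero[OF dist _ sub skew w_nz] by metis
qed

end
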